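(* For every integer $n\ge1$, $spt_o(2n)=spt(n)$, where $spt_o(m):=spt_o^{+}(m)-spt_o^{-}(m)$.
   Context: For a nonempty integer partition $\pi$, let $s(\pi)$ be its smallest part. Call $\pi$ admissible if no odd part of $\pi$ is greater than $2s(\pi)$. $spt_o^{+}(m)$ is the total number of occurrences of the smallest part, summed over all admissible partitions $\pi$ of $m$. For $l\ge1$ let $\delta_l=(l-1,l-2,\dots,1)$ be the triangular partition of size $\binom{l}{2}$; $spt_o^{-}(m)$ is the total number of occurrences of $s(\pi)$ in $\pi$, summed over all pairs $(\pi,\delta_{s(\pi)})$ where $\pi$ is an admissible partition with $|\pi|+\binom{s(\pi)}{2}=m$. Equivalently, $\sum_{m\ge1}spt_o(m)q^m=\sum_{n\ge1}\frac{q^n(q^{2n+1};q^2)_\infty}{(1-q^n)^2(q^{n+1};q)_\infty}\bigl(1-q^{n(n-1)/2}\bigr)$, with $(a;q)_\infty=\prod_{k\ge0}(1-aq^k)$. $spt(n)$ is Andrews' function: the total number of occurrences of the smallest part, summed over all partitions of $n$. *)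

theory Defs
  imports Complex_Main "HOL-Library.Multiset"
begin

text \<open>
  An integer partition is the finite multiset of its (positive) parts, and the size of the
  partition is the sum of the parts, \<^term>\<open>sum_mset p\<close>; note that \<^term>\<open>size p\<close> is the
  number of parts.
\<close>

definition partitions :: "nat \<Rightarrow> nat multiset set" where
  "partitions n = {p. 0 \<notin># p \<and> sum_mset p = n}"

text \<open>\<^term>\<open>Min\<close> is unspecified on the empty set, so this is only used for nonempty partitions.\<close>

definition smallest_part :: "nat multiset \<Rightarrow> nat" where
  "smallest_part p = Min (set_mset p)"

definition num_smallest :: "nat multiset \<Rightarrow> nat" where
  "num_smallest p = count p (smallest_part p)"

definition spt :: "nat \<Rightarrow> nat" where
  "spt n = (\<Sum>p | p \<in> partitions n \<and> p \<noteq> {#}. num_smallest p)"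

definition admissible :: "nat multiset \<Rightarrow> bool" where
  "admissible p \<longleftrightarrow> p \<noteq> {#} \<and> (\<forall>x. x \<in># p \<and> odd x \<longrightarrow> x \<le> 2 * smallest_part p)"

definition spt_o_plus :: "nat \<Rightarrow> nat" where
  "spt_o_plus m = (\<Sum>p | p \<in> partitions m \<and> admissible p. num_smallest p)"

text \<open>The partition with parts \<open>l - 1, l - 2, \<dots>, 1\<close>.\<close>

definition triangular_partition :: "nat \<Rightarrow> nat multiset" where
  "triangular_partition l = mset_set {1..<l}"

definition admissible_pairs :: "nat \<Rightarrow> (nat multiset \<times> nat multiset) set" where
  "admissible_pairs m =
     {(p, d). 0 \<notin># p \<and> admissible p \<and> d = triangular_partition (smallest_part p) \<and>
              sum_mset p + (smallest_part p choose 2) = m}"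

definition spt_o_minus :: "nat \<Rightarrow> nat" where
  "spt_o_minus m = (\<Sum>(p, d) \<in> admissible_pairs m. num_smallest p)"

definition spt_o :: "nat \<Rightarrow> int" where
  "spt_o m = int (spt_o_plus m) - int (spt_o_minus m)"

text \<open>
  The sums above range over finite sets, and the second components of the pairs have the size
  that is added in their defining condition.
\<close>

lemma size_le_sum_mset:
  fixes p :: "nat multiset"
  assumes "0 \<notin># p"
  shows "size p \<le> sum_mset p"
  using assms by (induction p) auto

lemma finite_partitions: "finite (partitions n)"
proof (rule finite_subset)
  show "partitions n \<subseteq> mset ` {xs. set xs \<subseteq> {..n} \<and> length xs \<le> n}"
  proof
    fix p assume p: "p \<in> partitions n"
    obtain xs where xs: "p = mset xs"
      by (metis ex_mset)
    have "length xs \<le> n"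
      using p size_le_sum_mset[of p] by (simp add: partitions_def xs)
    moreover have "x \<le> n" if "x \<in> set xs" for x
      using p member_le_sum_list[of x xs] that
      by (simp add: partitions_def xs sum_mset_sum_list)
    ultimately show "p \<in> mset ` {xs. set xs \<subseteq> {..n} \<and> length xs \<le> n}"
      using xs by auto
  qed
qed (simp add: finite_lists_length_le)

lemma finite_admissible_pairs: "finite (admissible_pairs m)"
proof (rule finite_subset)
  show "admissible_pairs m \<subseteq>
          (\<lambda>p. (p, triangular_partition (smallest_part p))) ` (\<Union>k\<le>m. partitions k)"
    by (auto simp: admissible_pairs_def partitions_def)
qed (simp add: finite_partitions)

lemma sum_mset_triangular_partition: "sum_mset (triangular_partition l) = l choose 2"
proof (induction l)
  case 0
  then show ?case by (simp add: triangular_partition_def)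
next
  case (Suc l)
  show ?case
  proof (cases "l = 0")
    case False
    then have "{1..<Suc l} = insert l {1..<l}" by auto
    with Suc show ?thesis
      by (simp add: triangular_partition_def numeral_2_eq_2)
  qed (simp add: triangular_partition_def)
qed

end

theory Submission
  imports Defs "HOL-Computational_Algebra.Formal_Laurent_Series"
begin

text \<open>
  After multiplication by $(q^2;q^2)_\infty$ the term of $spt_o$ with smallest part $n$ is
  $q^n (q)_n / ((1-q^n)^2 (q;q^2)_n)$ times $1 - q^{n(n-1)/2}$. Comparing coefficients in
  $1/(z)_\infty = (-z)_\infty / (z^2;q^2)_\infty$ gives
  $1/(q)_n = \sum_k q^{(n-2k)(n-2k-1)/2} / ((q)_{n-2k} (q^2;q^2)_k)$, and the summand $k = 0$
  is exactly what $spt_o^-$ subtracts. After exchanging summations, the inner sum for $k \ge 1$ is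
  the case $a = b = q^{2k}$ of the $q$-analogue of Gauss's second theorem
  \[ \sum_m \frac{(a)_m (b)_m q^{m(m+1)/2}}{(q)_m (abq;q^2)_m}
     = \frac{(aq;q^2)_\infty (bq;q^2)_\infty}{(q;q^2)_\infty (abq;q^2)_\infty}, \]
  and what remains is $q^{2k} (q^2;q^2)_k / (1-q^{2k})^2$, the $k$-th term of $spt$ in $q^2$. All
  parts may be bounded by $2N$, so that $(q^2;q^2)_N$ replaces the infinite product and the
  identities hold modulo $q^{N+1}$.
\<close>

section \<open>q-Pochhammer symbols\<close>

definition qpoch :: "'a::comm_ring_1 \<Rightarrow> 'a \<Rightarrow> nat \<Rightarrow> 'a" where
  "qpoch a q n = (\<Prod>j<n. 1 - a * q ^ j)"

lemma qpoch_0 [simp]: "qpoch a q 0 = 1"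
  by (simp add: qpoch_def)

lemma qpoch_Suc: "qpoch a q (Suc n) = qpoch a q n * (1 - a * q ^ n)"
  by (simp add: qpoch_def)

lemma qpoch_add: "qpoch a q (m + n) = qpoch a q m * qpoch (a * q ^ m) q n"
  by (induction n) (simp_all add: qpoch_Suc power_add algebra_simps)

lemma qpoch_Suc_left: "qpoch a q (Suc n) = (1 - a) * qpoch (a * q) q n"
  using qpoch_add[of a q 1 n] by (simp add: qpoch_Suc)

text \<open>Odd and even exponents of q are collected separately.\<close>

lemma qpoch_double: "qpoch q q (2 * n) = qpoch q (q\<^sup>2) n * qpoch (q\<^sup>2) (q\<^sup>2) n"
  by (induction n) (simp_all add: qpoch_Suc power_mult power2_eq_square algebra_simps)

lemma qpoch_nonzero:
  fixes a q :: "'a::idom"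
  assumes "\<And>j. a * q ^ j \<noteq> 1"
  shows "qpoch a q n \<noteq> 0"
  using assms by (auto simp: qpoch_def)

lemma Suc_choose_2: "Suc n choose 2 = (n choose 2) + n"
  by (simp add: numeral_2_eq_2)

section \<open>Gauss's second theorem\<close>

text \<open>The exponent \<open>Suc m choose 2\<close> is m(m+1)/2, so this is the m-th summand in
  Gauss's second theorem.\<close>

definition gauss_term :: "'a::field \<Rightarrow> 'a \<Rightarrow> 'a \<Rightarrow> nat \<Rightarrow> 'a" where
  "gauss_term q a b m = q ^ (Suc m choose 2) * qpoch a q m * qpoch b q m /
     (qpoch q q m * qpoch (a * b * q) (q\<^sup>2) m)"

text \<open>
  For \<^term>\<open>a = q ^ (2 * i)\<close> this relates the sums for \<^term>\<open>i\<close> and \<^term>\<open>i + 1\<close>, and for \<^term>\<open>a = 1\<close> the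
  sum is trivial. The right-hand side is the certificate $a (1-q^m) (1-abq) t_m(a) / (1-a)$ at
  $m = M + 1$, with the factor $1-a$ cancelled so that $a = 1$ is allowed.
\<close>

lemma gauss_term_telescope:
  fixes a b q :: "'a::field"
  assumes q: "\<And>j. j > 0 \<Longrightarrow> q ^ j \<noteq> 1" and ab: "\<And>j. a * b * q * (q\<^sup>2) ^ j \<noteq> 1"
  shows "(1 - a * b * q) * (\<Sum>m\<le>M. gauss_term q a b m)
           - (1 - a * q) * (\<Sum>m\<le>M. gauss_term q (a * q\<^sup>2) b m)
         = a * (1 - a * b * q) * q ^ (Suc (Suc M) choose 2) * qpoch (a * q) q M * qpoch b q (Suc M)
           / (qpoch q q M * qpoch (a * b * q) (q\<^sup>2) (Suc M))"
proof (induction M)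
  case 0
  have "a * b * q \<noteq> 1" using ab[of 0] by simp
  then show ?case
    by (simp add: gauss_term_def qpoch_Suc Suc_choose_2 divide_simps) (simp add: algebra_simps)
next
  case (Suc M)
  \<comment> \<open>With \<open>T\<close>, \<open>A\<close>, \<open>B\<close>, \<open>P\<close>,
    \<open>D\<close> as common factors, the passage from M to M + 1 becomes one polynomial identity
    in a, b, q and x.\<close>
  define x where "x = q ^ Suc M"
  define T where "T = q ^ (Suc (Suc M) choose 2)"
  define A where "A = qpoch (a * q) q M"
  define B where "B = qpoch b q (Suc M)"
  define P where "P = qpoch q q M"
  define D where "D = qpoch (a * b * q) (q\<^sup>2) (Suc M)"
  have P0: "P \<noteq> 0" unfolding P_def
    by (rule qpoch_nonzero) (metis power_Suc q zero_less_Suc)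
  have D0: "D \<noteq> 0" unfolding D_def by (rule qpoch_nonzero) (rule ab)
  have x1: "1 - x \<noteq> 0" unfolding x_def using q[of "Suc M"] by simp
  have c0: "1 - a * b * q \<noteq> 0" using ab[of 0] by simp
  have x2: "(q\<^sup>2) ^ Suc M = x\<^sup>2" unfolding x_def by (simp add: power_mult_distrib power2_eq_square)
  have d0: "1 - a * b * q * x\<^sup>2 \<noteq> 0" using ab[of "Suc M"] unfolding x2 by simp
  have PS: "qpoch q q (Suc M) = P * (1 - x)" by (simp add: qpoch_Suc P_def x_def)
  have DS: "qpoch (a * b * q) (q\<^sup>2) (Suc (Suc M)) = D * (1 - a * b * q * x\<^sup>2)"
    by (subst qpoch_Suc) (simp only: D_def x2)
  have BS: "qpoch b q (Suc (Suc M)) = B * (1 - b * x)"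
    by (subst qpoch_Suc) (simp only: B_def x_def)
  have AS: "qpoch (a * q) q (Suc M) = A * (1 - a * x)"
    by (subst qpoch_Suc) (simp add: A_def x_def mult.assoc)
  have TS: "q ^ (Suc (Suc (Suc M)) choose 2) = T * (q * x)"
    by (subst Suc_choose_2) (simp add: power_add T_def x_def)
  have t1: "gauss_term q a b (Suc M) = T * ((1 - a) * A) * B / (P * (1 - x) * D)"
    by (simp only: gauss_term_def PS T_def[symmetric] D_def[symmetric] B_def[symmetric]
      qpoch_Suc_left[of a] A_def[symmetric])
  \<comment> \<open>The prefactor 1 - aq extends the symbol at aq^2 downwards to one at aq, which
    contains \<open>A\<close>. In the same way 1 - abq turns the shifted denominator into a multiple
    of \<open>D\<close>.\<close>
  have "(1 - a * q) * qpoch (a * q\<^sup>2) q (Suc M) = qpoch (a * q) q (Suc (Suc M))"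
    by (subst (2) qpoch_Suc_left) (simp add: power2_eq_square mult.assoc)
  also have "\<dots> = A * (1 - a * x) * (1 - a * q * x)"
    by (subst qpoch_Suc) (simp only: AS x_def)
  finally have n1: "(1 - a * q) * qpoch (a * q\<^sup>2) q (Suc M) = A * (1 - a * x) * (1 - a * q * x)" .
  have "(1 - a * b * q) * qpoch (a * q\<^sup>2 * b * q) (q\<^sup>2) (Suc M) = D * (1 - a * b * q * x\<^sup>2)"
    unfolding DS[symmetric] by (subst (2) qpoch_Suc_left) (simp add: mult_ac)
  then have n2: "qpoch (a * q\<^sup>2 * b * q) (q\<^sup>2) (Suc M) = D * (1 - a * b * q * x\<^sup>2) / (1 - a * b * q)"
    using c0 by (simp add: field_simps)
  have "(1 - a * q) * gauss_term q (a * q\<^sup>2) b (Suc M) =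
      T * ((1 - a * q) * qpoch (a * q\<^sup>2) q (Suc M)) * B /
      (P * (1 - x) * qpoch (a * q\<^sup>2 * b * q) (q\<^sup>2) (Suc M))"
    by (simp only: gauss_term_def PS T_def[symmetric] B_def[symmetric]) simp
  also have "\<dots> = T * (A * (1 - a * x) * (1 - a * q * x)) * B * (1 - a * b * q) /
      (P * (1 - x) * (D * (1 - a * b * q * x\<^sup>2)))"
    unfolding n1 n2 by simp
  finally have t2: "(1 - a * q) * gauss_term q (a * q\<^sup>2) b (Suc M) = \<dots>" .
  have "(1 - a * b * q) * (\<Sum>m\<le>Suc M. gauss_term q a b m)
           - (1 - a * q) * (\<Sum>m\<le>Suc M. gauss_term q (a * q\<^sup>2) b m)
     = ((1 - a * b * q) * (\<Sum>m\<le>M. gauss_term q a b m)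
           - (1 - a * q) * (\<Sum>m\<le>M. gauss_term q (a * q\<^sup>2) b m))
       + (1 - a * b * q) * gauss_term q a b (Suc M)
       - (1 - a * q) * gauss_term q (a * q\<^sup>2) b (Suc M)"
    by (simp add: algebra_simps)
  also have "\<dots> = a * (1 - a * b * q) * T * A * B / (P * D)
      + (1 - a * b * q) * (T * ((1 - a) * A) * B / (P * (1 - x) * D))
      - T * (A * (1 - a * x) * (1 - a * q * x)) * B * (1 - a * b * q) /
      (P * (1 - x) * (D * (1 - a * b * q * x\<^sup>2)))"
    unfolding Suc.IH t1 t2 by (simp only: T_def A_def B_def P_def D_def)
  also have "\<dots> = (1 - a * b * q) * T * A * B / (P * D * (1 - x) * (1 - a * b * q * x\<^sup>2)) *
     (a * (1 - x) * (1 - a * b * q * x\<^sup>2) + (1 - a) * (1 - a * b * q * x\<^sup>2)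
       - (1 - a * x) * (1 - a * q * x))"
    using P0 D0 x1 d0 by (simp add: divide_simps) (simp add: algebra_simps)
  \<comment> \<open>The first two products add up to (1 - ax)(1 - abqx^2), so 1 - ax splits off. The
    other factors qx, 1 - ax and 1 - bx are those by which \<open>T\<close>, \<open>A\<close> and
    \<open>B\<close> grow.\<close>
  also have "a * (1 - x) * (1 - a * b * q * x\<^sup>2) + (1 - a) * (1 - a * b * q * x\<^sup>2)
       - (1 - a * x) * (1 - a * q * x) = a * (q * x) * (1 - a * x) * (1 - b * x)"
    by (simp add: algebra_simps power2_eq_square)
  finally show ?case unfolding TS AS BS DS PS by (simp add: mult_ac)
qed

section \<open>Expansion of the inverse q-Pochhammer symbol\<close>

lemma sum_even_multiples:
  fixes f :: "nat \<Rightarrow> 'a::comm_monoid_add"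
  shows "(\<Sum>j\<le>n. if even j then f j else 0) = (\<Sum>k\<le>n div 2. f (2 * k))"
proof -
  have "(\<Sum>j\<le>n. if even j then f j else 0) = sum f {j \<in> {..n}. even j}"
    by (rule sum.inter_filter[symmetric]) simp
  also have "{j \<in> {..n}. even j} = (*) 2 ` {..n div 2}"
    by (auto elim!: evenE)
  also have "sum f \<dots> = (\<Sum>k\<le>n div 2. f (2 * k))"
    by (subst sum.reindex) (auto simp: inj_on_def)
  finally show ?thesis .
qed

text \<open>
  In the proof, \<^term>\<open>A\<close> is $(-z)_\infty$, \<^term>\<open>B\<close> is $1/(z^2;q^2)_\infty$, and a prime denotes
  the substitution of $qz$ for $z$.
\<close>

lemma inverse_qpoch_expansion:
  fixes q :: "'a::field"
  assumes q: "\<And>j. j > 0 \<Longrightarrow> q ^ j \<noteq> 1"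
  shows "1 / qpoch q q n =
    (\<Sum>k\<le>n div 2. q ^ (n - 2 * k choose 2) / (qpoch q q (n - 2 * k) * qpoch (q\<^sup>2) (q\<^sup>2) k))"
proof -
  define a where "a n = q ^ (n choose 2) / qpoch q q n" for n
  define b where "b n = (if even n then 1 / qpoch (q\<^sup>2) (q\<^sup>2) (n div 2) else 0)" for n
  define A where "A = Abs_fps a"
  define A' where "A' = Abs_fps (\<lambda>n. q ^ n * a n)"
  define B where "B = Abs_fps b"
  define B' where "B' = Abs_fps (\<lambda>n. q ^ n * b n)"
  have q': "1 - q * q ^ j \<noteq> 0" for j
    using q[of "Suc j"] by simp
  have q2: "1 - q\<^sup>2 * (q\<^sup>2) ^ j \<noteq> 0" for j
    using q[of "2 * Suc j"] unfolding power_mult by simp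
  \<comment> \<open>\<open>aS\<close> and \<open>bS\<close> are the coefficient forms of A(z) = (1 +
    z) A(qz) and B(qz) = (1 - z^2) B(z).\<close>
  have aS: "a (Suc n) * (1 - q ^ Suc n) = q ^ n * a n" for n
    using q'[of n] by (simp add: a_def Suc_choose_2 qpoch_Suc power_add)
  have bS: "b (n + 2) * (1 - q ^ (n + 2)) = b n" for n
  proof (cases "even n")
    case True
    then obtain k where k: "n = 2 * k" by auto
    have "q ^ (n + 2) = q ^ (2 * Suc k)" by (simp add: k)
    then have "q ^ (n + 2) = q\<^sup>2 * (q\<^sup>2) ^ k" by (simp only: power_mult power_Suc)
    then show ?thesis using q2[of k] by (simp add: b_def k qpoch_Suc)
  qed (simp add: b_def)
  have "A $ n = ((1 + fps_X) * A') $ n" for n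
    using aS[of "n - 1"] by (cases n) (simp_all add: A_def A'_def algebra_simps)
  then have A: "A = (1 + fps_X) * A'" by (simp add: fps_eq_iff)
  have "B' $ n = ((1 - fps_X ^ 2) * B) $ n" for n
  proof (cases "n < 2")
    case True
    then have "n = 0 \<or> n = 1" by auto
    then show ?thesis by (auto simp: B_def B'_def b_def ring_distribs fps_X_power_mult_nth)
  next
    case False
    then obtain m where "n = m + 2" by (metis add.commute le_Suc_ex not_le)
    then show ?thesis using bS[of m]
      by (simp add: B_def B'_def ring_distribs fps_X_power_mult_nth) (simp add: algebra_simps)
  qed
  then have B: "B' = (1 - fps_X ^ 2) * B" by (simp add: fps_eq_iff)
  have AB: "(A' * B') $ n = q ^ n * (A * B) $ n" for n
    by (simp add: fps_mult_nth A_def A'_def B_def B'_def sum_distrib_left)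
      (intro sum.cong, auto simp: power_add[symmetric])
  \<comment> \<open>So C = AB satisfies (1 - z) C(z) = C(qz), the functional equation of
    1/(z)_infinity. With C(0) = 1 it forces the coefficients 1/(q)_n.\<close>
  have "(1 - fps_X) * (A * B) = A' * B'"
    unfolding A B by (simp add: power2_eq_square algebra_simps)
  then have step: "(A * B) $ Suc n - (A * B) $ n = q ^ Suc n * (A * B) $ Suc n" for n
    unfolding AB[symmetric] by (auto simp: left_diff_distrib dest!: arg_cong[of _ _ "\<lambda>f. f $ Suc n"])
  have "(A * B) $ n = 1 / qpoch q q n"
  proof (induction n)
    case 0
    then show ?case by (simp add: A_def B_def a_def b_def numeral_2_eq_2)
  next
    case (Suc n)
    have "(A * B) $ Suc n * (1 - q * q ^ n) = 1 / qpoch q q n"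
      using step[of n] Suc by (simp add: algebra_simps)
    then show ?case
      using q'[of n] by (metis divide_divide_eq_left nonzero_eq_divide_eq qpoch_Suc)
  qed
  \<comment> \<open>The factors are swapped so that the convolution index j belongs to
    \<open>B\<close>, where only even j = 2k contribute.\<close>
  then have "1 / qpoch q q n = (B * A) $ n" by (simp add: mult.commute)
  also have "\<dots> = (\<Sum>j\<le>n. if even j then
      q ^ (n - j choose 2) / (qpoch q q (n - j) * qpoch (q\<^sup>2) (q\<^sup>2) (j div 2)) else 0)"
    unfolding fps_mult_nth by (simp add: A_def B_def a_def b_def atLeast0AtMost)
      (intro sum.cong, auto)
  also have "\<dots> = (\<Sum>k\<le>n div 2. q ^ (n - 2 * k choose 2) / (qpoch q q (n - 2 * k) * qpoch (q\<^sup>2) (q\<^sup>2) k))"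
    by (subst sum_even_multiples) simp
  finally show ?thesis .
qed

section \<open>Partition generating functions\<close>

text \<open>The weight is the identity for \<open>spt_o\<close> and doubling for \<open>spt\<close>.
  Doubling turns the generating function of \<open>spt\<close> into a series in q^2.\<close>

definition weighted_partitions :: "(nat \<Rightarrow> nat) \<Rightarrow> nat set \<Rightarrow> nat \<Rightarrow> nat multiset set" where
  "weighted_partitions w A m = {p. set_mset p \<subseteq> A \<and> (\<Sum>x\<in>#p. w x) = m}"

definition partition_gf :: "(nat \<Rightarrow> nat) \<Rightarrow> nat set \<Rightarrow> rat fps" where
  "partition_gf w A = Abs_fps (\<lambda>m. of_nat (card (weighted_partitions w A m)))"

definition count_gf :: "(nat \<Rightarrow> nat) \<Rightarrow> nat set \<Rightarrow> nat \<Rightarrow> rat fps" where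
  "count_gf w A l = Abs_fps (\<lambda>m. of_nat (\<Sum>p\<in>weighted_partitions w A m. count p l))"

lemma finite_weighted_partitions:
  assumes "finite A" "\<And>x. x \<in> A \<Longrightarrow> w x > 0"
  shows "finite (weighted_partitions w A m)"
proof (rule finite_subset)
  show "weighted_partitions w A m \<subseteq> mset ` {xs. set xs \<subseteq> A \<and> length xs \<le> m}"
  proof
    fix p assume p: "p \<in> weighted_partitions w A m"
    have "set_mset p \<subseteq> A \<Longrightarrow> size p \<le> (\<Sum>x\<in>#p. w x)"
    proof (induction p)
      case (add x p)
      then show ?case using assms(2)[of x] by simp
    qed simp
    with p have "size p \<le> m" by (simp add: weighted_partitions_def)
    moreover obtain xs where "p = mset xs" by (metis ex_mset)
    ultimately show "p \<in> mset ` {xs. set xs \<subseteq> A \<and> length xs \<le> m}"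
      using p by (auto simp: weighted_partitions_def)
  qed
qed (simp add: finite_lists_length_le assms(1))

text \<open>Removing one copy of \<open>a\<close> is a bijection. Both recurrences below rest on
  it.\<close>

lemma weighted_partitions_containing:
  assumes "a \<in> A"
  shows "{p \<in> weighted_partitions w A m. a \<in># p} =
    (if w a \<le> m then add_mset a ` weighted_partitions w A (m - w a) else {})"
proof -
  have "p \<in> add_mset a ` weighted_partitions w A (m - w a) \<and> w a \<le> m"
    if "p \<in> weighted_partitions w A m" "a \<in># p" for p
  proof -
    obtain p' where "p = add_mset a p'" using \<open>a \<in># p\<close> by (metis insert_DiffM)
    then show ?thesis using that by (auto simp: weighted_partitions_def)
  qed
  then show ?thesis using assms by (auto simp: weighted_partitions_def)
qed

text \<open>Partitions that avoid \<open>a\<close> use parts from \<open>A\<close> only. The others,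
  with one copy of \<open>a\<close> removed, give the same series shifted by
  \<open>w a\<close>.\<close>

lemma partition_gf_insert:
  assumes "finite A" "a \<notin> A" "\<And>x. x \<in> insert a A \<Longrightarrow> w x > 0"
  shows "partition_gf w (insert a A) * (1 - fps_X ^ w a) = partition_gf w A"
proof -
  let ?B = "insert a A"
  have fin: "finite (weighted_partitions w ?B m)" for m
    by (rule finite_weighted_partitions) (use assms in auto)
  have "card (weighted_partitions w ?B m) = card (weighted_partitions w A m) +
    (if w a \<le> m then card (weighted_partitions w ?B (m - w a)) else 0)" for m
  proof -
    have "weighted_partitions w ?B m =
        {p \<in> weighted_partitions w ?B m. a \<notin># p} \<union> {p \<in> weighted_partitions w ?B m. a \<in># p}"
      by auto
    then have "card (weighted_partitions w ?B m) =
        card {p \<in> weighted_partitions w ?B m. a \<notin># p} + card {p \<in> weighted_partitions w ?B m. a \<in># p}"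
      using fin by (metis (no_types, lifting) card_Un_disjoint disjoint_iff finite_Un mem_Collect_eq)
    also have "{p \<in> weighted_partitions w ?B m. a \<notin># p} = weighted_partitions w A m"
      using assms(2) by (auto simp: weighted_partitions_def)
    also have "card {p \<in> weighted_partitions w ?B m. a \<in># p} =
        (if w a \<le> m then card (weighted_partitions w ?B (m - w a)) else 0)"
      by (simp add: weighted_partitions_containing card_image inj_on_def)
    finally show ?thesis .
  qed
  then show ?thesis
    by (simp add: fps_eq_iff partition_gf_def ring_distribs fps_X_power_mult_right_nth)
qed

lemma partition_gf_prod:
  assumes "finite A" "\<And>x. x \<in> A \<Longrightarrow> w x > 0"
  shows "partition_gf w A * (\<Prod>a\<in>A. 1 - fps_X ^ w a) = 1"
  using assms
proof (induction A rule: finite_induct)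
  case empty
  have "weighted_partitions w {} m = (if m = 0 then {{#}} else {})" for m
    by (auto simp: weighted_partitions_def)
  then show ?case by (simp add: fps_eq_iff partition_gf_def)
next
  case (insert a A)
  then show ?case
    using partition_gf_insert[of A a w] by (simp add: mult.assoc[symmetric])
qed

text \<open>Removing one copy of \<open>a\<close> lowers its multiplicity by one, so
  \<open>count_gf\<close> equals the shift of itself plus the shift of
  \<open>partition_gf\<close>.\<close>

lemma count_gf_partition_gf:
  assumes "finite A" "a \<in> A" "\<And>x. x \<in> A \<Longrightarrow> w x > 0"
  shows "count_gf w A a * (1 - fps_X ^ w a) = fps_X ^ w a * partition_gf w A"
proof -
  have fin: "finite (weighted_partitions w A m)" for m
    by (rule finite_weighted_partitions) (use assms in auto)
  have "(\<Sum>p\<in>weighted_partitions w A m. count p a) = (if w a \<le> m then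
     (\<Sum>p\<in>weighted_partitions w A (m - w a). count p a) + card (weighted_partitions w A (m - w a)) else 0)"
    for m
  proof -
    have "(\<Sum>p\<in>weighted_partitions w A m. count p a) =
      (\<Sum>p | p \<in> weighted_partitions w A m \<and> a \<in># p. count p a)"
      by (rule sum.mono_neutral_right) (use fin in \<open>auto simp: not_in_iff\<close>)
    also have "\<dots> = (if w a \<le> m then (\<Sum>p\<in>weighted_partitions w A (m - w a). count p a + 1) else 0)"
      unfolding weighted_partitions_containing[OF assms(2)] by (simp add: sum.reindex inj_on_def)
    finally show ?thesis by (simp only: sum.distrib card_eq_sum)
  qed
  then show ?thesis
    by (simp add: fps_eq_iff partition_gf_def count_gf_def ring_distribs
        fps_X_power_mult_right_nth fps_X_power_mult_nth)
qed

text \<open>One factor \<open>1 - fps_X ^ w l\<close> comes from allowing the part \<open>l\<close>,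
  the other from counting its occurrences.\<close>

lemma count_gf_product:
  assumes "finite A" "l \<notin> A" "\<And>x. x \<in> insert l A \<Longrightarrow> w x > 0"
  shows "count_gf w (insert l A) l * ((1 - fps_X ^ w l)\<^sup>2 * (\<Prod>a\<in>A. 1 - fps_X ^ w a)) = fps_X ^ w l"
proof -
  let ?B = "insert l A"
  have "count_gf w ?B l * ((1 - fps_X ^ w l)\<^sup>2 * (\<Prod>a\<in>A. 1 - fps_X ^ w a)) =
      (count_gf w ?B l * (1 - fps_X ^ w l)) * (\<Prod>a\<in>?B. 1 - fps_X ^ w a)"
    using assms by (simp add: power2_eq_square mult_ac)
  also have "\<dots> = fps_X ^ w l * (partition_gf w ?B * (\<Prod>a\<in>?B. 1 - fps_X ^ w a))"
    using assms by (subst count_gf_partition_gf) (auto simp: mult.assoc)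
  also have "\<dots> = fps_X ^ w l"
    using assms by (subst partition_gf_prod) auto
  finally show ?thesis .
qed

section \<open>Decomposition of spt and spt_o by the smallest part\<close>

lemma smallest_part_eq_iff:
  assumes "p \<noteq> {#}"
  shows "smallest_part p = l \<longleftrightarrow> l \<in># p \<and> (\<forall>x\<in>#p. l \<le> x)"
  unfolding smallest_part_def using assms by (subst Min_eq_iff) auto

lemma part_le:
  assumes "p \<in> partitions m" "x \<in># p"
  shows "x \<le> m"
proof -
  obtain p' where "p = add_mset x p'" using assms(2) by (rule mset_add)
  then show ?thesis using assms(1) by (auto simp: partitions_def)
qed

lemma smallest_part_in_range:
  assumes "p \<in> partitions m" "p \<noteq> {#}"
  shows "smallest_part p \<in> {1..m}"
proof -
  have "smallest_part p \<in># p" using smallest_part_eq_iff[OF assms(2)] by blast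
  moreover from this have "smallest_part p \<noteq> 0"
    using assms(1) by (metis (no_types, lifting) mem_Collect_eq partitions_def)
  ultimately show ?thesis using part_le[OF assms(1)] by simp
qed

text \<open>Partitions are grouped by their smallest part \<open>l\<close>. No part exceeds
  \<open>m\<close>, so restricting the parts to \<open>{l..N}\<close> loses nothing.\<close>

lemma spt_eq_count_gf:
  assumes "m \<le> N"
  shows "of_nat (spt m) = (\<Sum>l=1..N. count_gf (\<lambda>x. 2 * x) {l..N} l) $ (2 * m)"
proof -
  let ?S = "{p. p \<in> partitions m \<and> p \<noteq> {#}}"
  let ?W = "\<lambda>l. weighted_partitions (\<lambda>x. 2 * x) {l..N} (2 * m)"
  have "spt m = (\<Sum>l=1..N. \<Sum>p | p \<in> ?S \<and> smallest_part p = l. num_smallest p)"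
    unfolding spt_def
  proof (rule sum.group[symmetric])
    show "finite ?S" by (rule finite_subset[OF _ finite_partitions[of m]]) auto
    show "smallest_part ` ?S \<subseteq> {1..N}"
    proof (rule image_subsetI)
      fix p assume "p \<in> ?S"
      then show "smallest_part p \<in> {1..N}"
        using smallest_part_in_range[of p m] assms by auto
    qed
  qed simp
  also have "\<dots> = (\<Sum>l=1..N. \<Sum>p\<in>?W l. count p l)"
  proof (rule sum.cong[OF refl])
    fix l assume l: "l \<in> {1..N}"
    have eq: "{p. p \<in> ?S \<and> smallest_part p = l} = {p \<in> ?W l. l \<in># p}"
    proof (intro equalityI subsetI)
      fix p assume p: "p \<in> {p. p \<in> ?S \<and> smallest_part p = l}"
      then have "l \<in># p" "\<forall>x\<in>#p. l \<le> x" using smallest_part_eq_iff[of p l] by auto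
      moreover have "x \<le> N" if "x \<in># p" for x using p that assms part_le[of p m x] by simp
      ultimately show "p \<in> {p \<in> ?W l. l \<in># p}"
        using p by (auto simp: weighted_partitions_def partitions_def sum_mset_distrib_left[symmetric])
    next
      fix p assume p: "p \<in> {p \<in> ?W l. l \<in># p}"
      then have "p \<noteq> {#}" "\<forall>x\<in>#p. l \<le> x" by (auto simp: weighted_partitions_def)
      with p have "smallest_part p = l" by (simp add: smallest_part_eq_iff)
      moreover have "0 \<notin># p" using l \<open>\<forall>x\<in>#p. l \<le> x\<close> by force
      ultimately show "p \<in> {p. p \<in> ?S \<and> smallest_part p = l}"
        using p by (auto simp: weighted_partitions_def partitions_def sum_mset_distrib_left[symmetric])
    qed
    have "(\<Sum>p | p \<in> ?S \<and> smallest_part p = l. num_smallest p) = (\<Sum>p | p \<in> ?W l \<and> l \<in># p. count p l)"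
    proof (rule sum.cong[OF eq])
      fix p assume "p \<in> {p \<in> ?W l. l \<in># p}"
      then have "smallest_part p = l" unfolding eq[symmetric] by simp
      then show "num_smallest p = count p l" by (simp add: num_smallest_def)
    qed
    also have "\<dots> = (\<Sum>p\<in>?W l. count p l)"
    \<comment> \<open>Partitions without the part \<open>l\<close> have count 0, so they may be
      added to the sum.\<close>
    proof (rule sum.mono_neutral_left)
      show "finite (?W l)" by (rule finite_weighted_partitions) (use l in auto)
    qed (auto simp: not_in_iff)
    finally show "(\<Sum>p | p \<in> ?S \<and> smallest_part p = l. num_smallest p) = (\<Sum>p\<in>?W l. count p l)" .
  qed
  finally show ?thesis by (simp add: fps_sum_nth count_gf_def)
qed

text \<open>These are the parts allowed beside the smallest part \<open>l\<close>, which is left out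
  because its factor is squared. The bound \<open>2 * N\<close> makes the even ones among them
  exactly the doubles of numbers up to \<open>N\<close>.\<close>

definition admissible_parts :: "nat \<Rightarrow> nat \<Rightarrow> nat set" where
  "admissible_parts N l = {x \<in> {l<..2 * N}. odd x \<longrightarrow> x \<le> 2 * l}"

lemma sum_admissible_smallest_part:
  assumes "m \<le> N" "l \<in> {1..N}"
  shows "(\<Sum>p | p \<in> partitions m \<and> admissible p \<and> smallest_part p = l. num_smallest p) =
    (\<Sum>p\<in>weighted_partitions (\<lambda>x. x) (insert l (admissible_parts N l)) m. count p l)"
proof -
  let ?W = "weighted_partitions (\<lambda>x. x) (insert l (admissible_parts N l)) m"
  have eq: "{p. p \<in> partitions m \<and> admissible p \<and> smallest_part p = l} = {p \<in> ?W. l \<in># p}"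
  proof (intro equalityI subsetI)
    fix p assume p: "p \<in> {p. p \<in> partitions m \<and> admissible p \<and> smallest_part p = l}"
    then have l': "l \<in># p" "\<forall>x\<in>#p. l \<le> x"
      using smallest_part_eq_iff[of p l] by (auto simp: admissible_def)
    have "x \<in> insert l (admissible_parts N l)" if "x \<in># p" for x
      using p l' that assms part_le[of p m x]
      by (force simp: admissible_def admissible_parts_def)
    with p l' show "p \<in> {p \<in> ?W. l \<in># p}"
      by (auto simp: weighted_partitions_def partitions_def)
  next
    fix p assume p: "p \<in> {p \<in> ?W. l \<in># p}"
    then have ne: "p \<noteq> {#}" by auto
    have l': "\<forall>x\<in>#p. l \<le> x" "\<forall>x\<in>#p. odd x \<longrightarrow> x \<le> 2 * l"
      using p by (auto simp: weighted_partitions_def admissible_parts_def)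
    have "smallest_part p = l" using p l' ne by (simp add: smallest_part_eq_iff)
    moreover have "0 \<notin># p" using l' assms(2) by force
    ultimately show "p \<in> {p. p \<in> partitions m \<and> admissible p \<and> smallest_part p = l}"
      using p l' ne by (simp add: admissible_def partitions_def weighted_partitions_def)
  qed
  have "(\<Sum>p | p \<in> partitions m \<and> admissible p \<and> smallest_part p = l. num_smallest p) =
      (\<Sum>p | p \<in> ?W \<and> l \<in># p. count p l)"
    by (rule sum.cong) (use eq in \<open>auto simp: num_smallest_def\<close>)
  also have "\<dots> = (\<Sum>p\<in>?W. count p l)"
    by (rule sum.mono_neutral_left)
      (use assms in \<open>auto simp: not_in_iff admissible_parts_def intro!: finite_weighted_partitions\<close>)
  finally show ?thesis .
qed

lemma spt_o_plus_eq_count_gf: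
  assumes "m \<le> N"
  shows "of_nat (spt_o_plus m) =
    (\<Sum>l=1..N. count_gf (\<lambda>x. x) (insert l (admissible_parts N l)) l) $ m"
proof -
  let ?S = "{p. p \<in> partitions m \<and> admissible p}"
  have "spt_o_plus m = (\<Sum>l=1..N. \<Sum>p | p \<in> ?S \<and> smallest_part p = l. num_smallest p)"
    unfolding spt_o_plus_def
  proof (rule sum.group[symmetric])
    show "finite ?S" by (rule finite_subset[OF _ finite_partitions[of m]]) auto
    show "smallest_part ` ?S \<subseteq> {1..N}"
    proof (rule image_subsetI)
      fix p assume "p \<in> ?S"
      then show "smallest_part p \<in> {1..N}"
        using smallest_part_in_range[of p m] assms by (auto simp: admissible_def)
    qed
  qed simp
  also have "\<dots> = (\<Sum>l=1..N. \<Sum>p\<in>weighted_partitions (\<lambda>x. x) (insert l (admissible_parts N l)) m. count p l)"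
  proof (rule sum.cong[OF refl])
    fix l assume "l \<in> {1..N}"
    from sum_admissible_smallest_part[OF assms this]
    show "(\<Sum>p | p \<in> ?S \<and> smallest_part p = l. num_smallest p) =
      (\<Sum>p\<in>weighted_partitions (\<lambda>x. x) (insert l (admissible_parts N l)) m. count p l)"
      by (simp add: conj_assoc)
  qed
  finally show ?thesis by (simp add: fps_sum_nth count_gf_def)
qed

text \<open>A pair is determined by its first component, and the triangular partition only adds
  \<open>l choose 2\<close> to the size. This shifts the series for smallest part
  \<open>l\<close>.\<close>

lemma spt_o_minus_eq_count_gf:
  assumes "m \<le> N"
  shows "of_nat (spt_o_minus m) =
    (\<Sum>l=1..N. fps_X ^ (l choose 2) * count_gf (\<lambda>x. x) (insert l (admissible_parts N l)) l) $ m"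
proof -
  let ?S = "{p. 0 \<notin># p \<and> admissible p \<and> sum_mset p + (smallest_part p choose 2) = m}"
  let ?W = "\<lambda>l m. weighted_partitions (\<lambda>x. x) (insert l (admissible_parts N l)) m"
  have fin: "finite ?S"
  proof (rule finite_subset)
    show "?S \<subseteq> (\<Union>k\<le>m. partitions k)"
    proof
      fix p assume "p \<in> ?S"
      then have "0 \<notin># p" "sum_mset p + (smallest_part p choose 2) = m" by simp_all
      then have "p \<in> partitions (sum_mset p)" "sum_mset p \<in> {..m}" by (simp_all add: partitions_def)
      then show "p \<in> (\<Union>k\<le>m. partitions k)" by (rule UN_I[rotated])
    qed
  qed (simp add: finite_partitions)
  have range: "smallest_part ` ?S \<subseteq> {1..N}"
  proof
    fix l assume "l \<in> smallest_part ` ?S"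
    then obtain p where "p \<in> ?S" and l: "l = smallest_part p" by (elim imageE)
    then have p: "0 \<notin># p" "admissible p" "sum_mset p + (smallest_part p choose 2) = m" by simp_all
    have "smallest_part p \<in> {1..sum_mset p}"
      by (rule smallest_part_in_range) (use p in \<open>simp_all add: partitions_def admissible_def\<close>)
    moreover have "sum_mset p \<le> m" using p(3) by simp
    ultimately show "l \<in> {1..N}" using assms l by simp
  qed
  have "admissible_pairs m = (\<lambda>p. (p, triangular_partition (smallest_part p))) ` ?S"
    by (auto simp: admissible_pairs_def)
  then have "spt_o_minus m = (\<Sum>p\<in>?S. num_smallest p)"
    by (simp add: spt_o_minus_def sum.reindex inj_on_def)
  also have "\<dots> = (\<Sum>l=1..N. \<Sum>p | p \<in> ?S \<and> smallest_part p = l. num_smallest p)"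
    by (rule sum.group[symmetric, OF fin _ range]) simp
  \<comment> \<open>The case distinction guards the truncated subtraction: a triangular partition
    larger than \<open>m\<close> occurs in no pair.\<close>
  also have "\<dots> = (\<Sum>l=1..N. if l choose 2 \<le> m then \<Sum>p\<in>?W l (m - (l choose 2)). count p l else 0)"
  proof (rule sum.cong[OF refl])
    fix l assume l: "l \<in> {1..N}"
    show "(\<Sum>p | p \<in> ?S \<and> smallest_part p = l. num_smallest p) =
      (if l choose 2 \<le> m then \<Sum>p\<in>?W l (m - (l choose 2)). count p l else 0)"
    proof (cases "l choose 2 \<le> m")
      case True
      then have "{p. p \<in> ?S \<and> smallest_part p = l} =
          {p. p \<in> partitions (m - (l choose 2)) \<and> admissible p \<and> smallest_part p = l}"
        by (auto simp: partitions_def)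
      then show ?thesis using True sum_admissible_smallest_part[OF _ l, of "m - (l choose 2)"] assms
        by simp
    next
      case False
      then have "{p. p \<in> ?S \<and> smallest_part p = l} = {}" by auto
      with False show ?thesis by (simp only: sum.empty if_False)
    qed
  qed
  finally show ?thesis
    by (auto simp: fps_sum_nth count_gf_def fps_X_power_mult_nth intro!: sum.cong)
qed

section \<open>Congruences modulo powers of q\<close>

definition fls_vanishes :: "nat \<Rightarrow> rat fls \<Rightarrow> bool" where
  "fls_vanishes N x \<longleftrightarrow> (\<exists>y. x = fls_X ^ N * fps_to_fls y)"

text \<open>
  Congruence modulo \<^term>\<open>fls_X ^ N\<close> may be multiplied by \<^term>\<open>x\<close> only if \<^term>\<open>x\<close> has no
  polar part, which is what \<^term>\<open>fls_vanishes 0 x\<close> says.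
\<close>

lemma fls_vanishes_add: "fls_vanishes N x \<Longrightarrow> fls_vanishes N y \<Longrightarrow> fls_vanishes N (x + y)"
  unfolding fls_vanishes_def by (metis distrib_left fps_to_fls_plus)

lemma fls_vanishes_diff: "fls_vanishes N x \<Longrightarrow> fls_vanishes N y \<Longrightarrow> fls_vanishes N (x - y)"
  unfolding fls_vanishes_def by (metis right_diff_distrib fps_to_fls_minus)

lemma fls_vanishes_0 [simp]: "fls_vanishes N 0"
  unfolding fls_vanishes_def by (rule exI[of _ 0]) simp

lemma fls_vanishes_sum: "(\<And>i. i \<in> S \<Longrightarrow> fls_vanishes N (f i)) \<Longrightarrow> fls_vanishes N (sum f S)"
  by (induction S rule: infinite_finite_induct) (auto intro: fls_vanishes_add)

lemma fls_vanishes_mult: "fls_vanishes M x \<Longrightarrow> fls_vanishes N y \<Longrightarrow> fls_vanishes (M + N) (x * y)"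
proof -
  assume "fls_vanishes M x" "fls_vanishes N y"
  then obtain u v where "x = fls_X ^ M * fps_to_fls u" "y = fls_X ^ N * fps_to_fls v"
    unfolding fls_vanishes_def by blast
  then have "x * y = fls_X ^ (M + N) * fps_to_fls (u * v)"
    by (simp add: power_add fls_times_fps_to_fls mult_ac)
  then show ?thesis unfolding fls_vanishes_def by blast
qed

lemma fls_vanishes_mult_left: "fls_vanishes 0 x \<Longrightarrow> fls_vanishes N y \<Longrightarrow> fls_vanishes N (x * y)"
  using fls_vanishes_mult[of 0 x N y] by simp

lemma fls_vanishes_X_power: "M \<le> N \<Longrightarrow> fls_vanishes M (fls_X ^ N)"
  unfolding fls_vanishes_def
  by (rule exI[of _ "fps_X ^ (N - M)"]) (simp add: fps_to_fls_power power_add[symmetric])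

lemma fls_vanishes_1: "fls_vanishes 0 1"
  using fls_vanishes_X_power[of 0 0] by simp

lemma fls_vanishes_nth:
  assumes "fls_vanishes N (fps_to_fls x)" "n < N"
  shows "x $ n = 0"
proof -
  obtain y where "fps_to_fls x = fps_to_fls (fps_X ^ N * y)"
    using assms(1) unfolding fls_vanishes_def by (auto simp: fls_times_fps_to_fls fps_to_fls_power)
  then have "x = fps_X ^ N * y" by simp
  with assms(2) show ?thesis by (simp add: fps_X_power_mult_nth)
qed

text \<open>A power series with constant term 1 is already invertible among power series.\<close>

lemma fls_vanishes_inverse:
  assumes "x $ 0 = 1"
  shows "fls_vanishes 0 (1 / fps_to_fls x)"
proof -
  have "x * inverse x = 1" using assms by (simp add: inverse_mult_eq_1')
  then have "fps_to_fls x * fps_to_fls (inverse x) = 1"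
    by (metis fls_times_fps_to_fls fps_one_to_fls)
  moreover from this have "fps_to_fls x \<noteq> 0" by auto
  ultimately have "1 / fps_to_fls x = fls_X ^ 0 * fps_to_fls (inverse x)"
    by (simp add: field_simps)
  then show ?thesis unfolding fls_vanishes_def by blast
qed

section \<open>q-Pochhammer symbols as Laurent series, and the truncated Gauss sum\<close>

text \<open>The field of Laurent series permits division. Coming from power series, the symbols have
  no polar part, and for \<open>i > 0\<close> neither have their inverses.\<close>

lemma qpoch_fls:
  "qpoch (fls_X ^ i) (fls_X ^ d) n = fps_to_fls (qpoch (fps_X ^ i) (fps_X ^ d :: rat fps) n)"
  by (induction n) (simp_all add: qpoch_Suc fls_times_fps_to_fls fps_to_fls_power)

lemma qpoch_fps_nth_0: "i > 0 \<Longrightarrow> qpoch (fps_X ^ i) (fps_X ^ d :: rat fps) n $ 0 = 1"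
  by (induction n) (simp_all add: qpoch_Suc)

lemma fls_vanishes_qpoch: "fls_vanishes 0 (qpoch (fls_X ^ i) (fls_X ^ d) n)"
  unfolding qpoch_fls fls_vanishes_def by auto

lemma fls_vanishes_inverse_qpoch: "i > 0 \<Longrightarrow> fls_vanishes 0 (1 / qpoch (fls_X ^ i) (fls_X ^ d) n)"
  unfolding qpoch_fls by (intro fls_vanishes_inverse qpoch_fps_nth_0)

lemma fls_X_power_neq_1: "j > 0 \<Longrightarrow> (fls_X :: rat fls) ^ j \<noteq> 1"
proof
  assume "j > 0" "(fls_X :: rat fls) ^ j = 1"
  then have "fls_nth ((fls_X :: rat fls) ^ j) 0 = 1" by simp
  with \<open>j > 0\<close> show False by simp
qed

lemma qpoch_fls_nonzero: "i > 0 \<Longrightarrow> qpoch (fls_X ^ i) (fls_X ^ d) n \<noteq> (0 :: rat fls)"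
  by (rule qpoch_nonzero) (simp add: power_mult[symmetric] power_add[symmetric] fls_X_power_neq_1)

lemma qpoch_1_left: "m > 0 \<Longrightarrow> qpoch 1 q m = 0"
  by (cases m) (simp_all add: qpoch_Suc_left)

text \<open>Gauss's second theorem for a = q^(2i) and b = q^(2k), where the infinite products reduce
  to a quotient of finite ones. The induction on \<open>i\<close> replaces a by aq^2 with
  \<open>gauss_term_telescope\<close>.\<close>

lemma fls_vanishes_gauss_sum:
  fixes q :: "rat fls"
  defines "q \<equiv> fls_X"
  shows "fls_vanishes (Suc M) ((\<Sum>m\<le>M. gauss_term q (q ^ (2 * i)) (q ^ (2 * k)) m) -
     qpoch (q ^ (2 * k + 1)) (q\<^sup>2) i / qpoch q (q\<^sup>2) i)"
proof (induction i)
  case 0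
  \<comment> \<open>For a = 1 every summand with m > 0 contains the factor 1 - a = 0.\<close>
  have "(\<Sum>m\<le>M. gauss_term q (q ^ (2 * 0)) (q ^ (2 * k)) m) = (\<Sum>m\<le>M. if m = 0 then 1 else 0)"
    by (rule sum.cong) (auto simp: gauss_term_def qpoch_1_left numeral_2_eq_2)
  then show ?case by simp
next
  case (Suc i)
  define a where "a = q ^ (2 * i)"
  define b where "b = q ^ (2 * k)"
  define S where "S a = (\<Sum>m\<le>M. gauss_term q a b m)" for a
  define c where "c = qpoch (q ^ (2 * k + 1)) (q\<^sup>2) i / qpoch q (q\<^sup>2) i"
  define r where "r = a * (1 - a * b * q) * q ^ (Suc (Suc M) choose 2) *
    qpoch (a * q) q M * qpoch b q (Suc M) / (qpoch q q M * qpoch (a * b * q) (q\<^sup>2) (Suc M))"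
  have aq: "a * q = q ^ (2 * i + 1)" by (simp add: a_def)
  have abq: "a * b * q = q ^ (2 * i + 2 * k + 1)" by (simp add: a_def b_def power_add)
  have a2: "a * q\<^sup>2 = q ^ (2 * Suc i)" by (simp add: a_def power_add power2_eq_square mult_ac)
  have ne: "1 - a * q \<noteq> 0" unfolding aq unfolding q_def using fls_X_power_neq_1[of "2 * i + 1"] by simp
  \<comment> \<open>The exponent (M+1)(M+2)/2 is at least M + 1, so the boundary term
    \<open>r\<close> of the telescoping is negligible.\<close>
  have "fls_vanishes (Suc M) (q ^ (Suc (Suc M) choose 2))"
    unfolding q_def by (rule fls_vanishes_X_power) (simp add: Suc_choose_2)
  then have r: "fls_vanishes (Suc M) r"
  proof -
    assume *: "fls_vanishes (Suc M) (q ^ (Suc (Suc M) choose 2))"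
    have "r = (a * (1 - a * b * q) * qpoch (a * q) q M * qpoch b q (Suc M) *
       (1 / qpoch q q M) * (1 / qpoch (a * b * q) (q\<^sup>2) (Suc M))) * q ^ (Suc (Suc M) choose 2)"
      by (simp add: r_def mult_ac)
    moreover have "fls_vanishes 0 (a * (1 - a * b * q) * qpoch (a * q) q M * qpoch b q (Suc M) *
       (1 / qpoch q q M) * (1 / qpoch (a * b * q) (q\<^sup>2) (Suc M)))"
      unfolding abq aq unfolding a_def b_def q_def
      by (intro fls_vanishes_mult_left fls_vanishes_diff fls_vanishes_1 fls_vanishes_X_power
        fls_vanishes_qpoch[of _ 1, simplified] fls_vanishes_inverse_qpoch[of _ 2]
        fls_vanishes_inverse_qpoch[of 1 1, simplified]) simp_all
    ultimately show ?thesis using * by (simp only: fls_vanishes_mult_left)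
  qed
  \<comment> \<open>A single factor is a symbol of length 1, for which the base exponent 0 is an
    arbitrary choice.\<close>
  have inv: "fls_vanishes 0 (1 / (1 - a * q))"
    using fls_vanishes_inverse_qpoch[of "2 * i + 1" 0 1] unfolding aq unfolding q_def by (simp add: qpoch_Suc)
  have "(1 - a * b * q) * S a - (1 - a * q) * S (a * q\<^sup>2) = r"
    unfolding S_def r_def
  proof (rule gauss_term_telescope)
    show "a * b * q * (q\<^sup>2) ^ j \<noteq> 1" for j
      unfolding abq unfolding q_def power_mult[symmetric] power_add[symmetric]
      by (rule fls_X_power_neq_1) simp
  qed (simp add: q_def fls_X_power_neq_1)
  then have Seq: "S (a * q\<^sup>2) = ((1 - a * b * q) * S a - r) / (1 - a * q)"
    using ne by (simp add: field_simps)
  have "(q\<^sup>2) ^ i = a" by (simp only: a_def power_mult)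
  then have quot: "qpoch (q ^ (2 * k + 1)) (q\<^sup>2) (Suc i) / qpoch q (q\<^sup>2) (Suc i) =
      c * (1 - a * b * q) / (1 - a * q)"
    by (simp add: qpoch_Suc c_def b_def mult_ac)
  have alg: "(x * s - r) / d - c * x / d = (1 / d) * (x * (s - c) - r)" for x s r d c :: "rat fls"
    by (cases "d = 0") (simp_all add: field_simps)
  have "S (a * q\<^sup>2) - qpoch (q ^ (2 * k + 1)) (q\<^sup>2) (Suc i) / qpoch q (q\<^sup>2) (Suc i) =
     (1 / (1 - a * q)) * ((1 - a * b * q) * (S a - c) - r)"
    unfolding Seq quot by (rule alg)
  moreover have "fls_vanishes (Suc M) \<dots>"
  proof (intro fls_vanishes_mult_left[OF inv] fls_vanishes_diff r)
    show "fls_vanishes (Suc M) ((1 - a * b * q) * (S a - c))"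
    proof (rule fls_vanishes_mult_left)
      show "fls_vanishes 0 (1 - a * b * q)" unfolding abq unfolding q_def
        by (intro fls_vanishes_diff fls_vanishes_1 fls_vanishes_X_power) simp
      show "fls_vanishes (Suc M) (S a - c)"
        using Suc.IH by (simp add: S_def c_def a_def b_def)
    qed
  qed
  ultimately show ?case by (simp add: S_def a2 b_def)
qed

section \<open>The identity for spt\<close>

lemma qpoch_prod_greaterThanAtMost:
  assumes "m \<le> n"
  shows "qpoch q q m * (\<Prod>a\<in>{m<..n}. 1 - q ^ a) = qpoch q q n"
  using assms
proof (induction n rule: dec_induct)
  case (step n)
  then have "{m<..Suc n} = insert (Suc n) {m<..n}" by auto
  then have "qpoch q q m * (\<Prod>a\<in>{m<..Suc n}. 1 - q ^ a) =
      (qpoch q q m * (\<Prod>a\<in>{m<..n}. 1 - q ^ a)) * (1 - q ^ Suc n)"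
    by (simp add: mult_ac)
  then show ?case by (simp add: step.IH qpoch_Suc)
qed simp

text \<open>The parts are those in \<open>{l<..2 * l}\<close> and the doubles of
  \<open>{l<..N}\<close>. Multiplying by (q)_l and (q^2;q^2)_l completes both products. Then
  (q)_(2l) splits by \<open>qpoch_double\<close>, and (q^2;q^2)_l cancels.\<close>

lemma prod_admissible_parts:
  fixes q :: "'a::field"
  assumes "l \<le> N" "\<And>j. j > 0 \<Longrightarrow> q ^ j \<noteq> 1"
  shows "(\<Prod>a\<in>admissible_parts N l. 1 - q ^ a) * qpoch q q l = qpoch q (q\<^sup>2) l * qpoch (q\<^sup>2) (q\<^sup>2) N"
proof -
  have *: "admissible_parts N l = {l<..2 * l} \<union> (*) 2 ` {l<..N}"
    using assms(1) by (auto simp: admissible_parts_def elim!: evenE)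
  have "(\<Prod>a\<in>admissible_parts N l. 1 - q ^ a) =
      (\<Prod>a\<in>{l<..2 * l}. 1 - q ^ a) * (\<Prod>a\<in>(*) 2 ` {l<..N}. 1 - q ^ a)"
    unfolding * by (rule prod.union_disjoint) auto
  also have "(\<Prod>a\<in>(*) 2 ` {l<..N}. 1 - q ^ a) = (\<Prod>a\<in>{l<..N}. 1 - (q\<^sup>2) ^ a)"
    by (subst prod.reindex) (auto simp: inj_on_def power_mult)
  finally have "(\<Prod>a\<in>admissible_parts N l. 1 - q ^ a) * qpoch q q l * qpoch (q\<^sup>2) (q\<^sup>2) l =
      (qpoch q q l * (\<Prod>a\<in>{l<..2 * l}. 1 - q ^ a)) *
      (qpoch (q\<^sup>2) (q\<^sup>2) l * (\<Prod>a\<in>{l<..N}. 1 - (q\<^sup>2) ^ a))"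
    by (simp add: mult_ac)
  also have "\<dots> = qpoch q q (2 * l) * qpoch (q\<^sup>2) (q\<^sup>2) N"
    using assms(1) by (simp add: qpoch_prod_greaterThanAtMost)
  also have "\<dots> = qpoch q (q\<^sup>2) l * qpoch (q\<^sup>2) (q\<^sup>2) N * qpoch (q\<^sup>2) (q\<^sup>2) l"
    unfolding qpoch_double by (simp add: mult_ac)
  finally show ?thesis
  proof (rule mult_right_cancel[THEN iffD1, rotated])
    have "q\<^sup>2 * (q\<^sup>2) ^ j \<noteq> 1" for j
      using assms(2)[of "2 * Suc j"] unfolding power_mult by simp
    then show "qpoch (q\<^sup>2) (q\<^sup>2) l \<noteq> 0" by (rule qpoch_nonzero)
  qed
qed

lemma fps_to_fls_prod: "fps_to_fls (prod f A) = (\<Prod>a\<in>A. fps_to_fls (f a))"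
  by (induction A rule: infinite_finite_induct) (simp_all add: fls_times_fps_to_fls)

lemma fps_to_fls_sum: "fps_to_fls (sum f A) = (\<Sum>a\<in>A. fps_to_fls (f a))"
  by (induction A rule: infinite_finite_induct) simp_all

lemma fls_count_gf:
  assumes "finite A" "l \<notin> A" "\<And>x. x \<in> insert l A \<Longrightarrow> w x > 0"
  shows "fps_to_fls (count_gf w (insert l A) l) *
    ((1 - fls_X ^ w l)\<^sup>2 * (\<Prod>a\<in>A. 1 - fls_X ^ w a)) = fls_X ^ w l"
  using arg_cong[OF count_gf_product[OF assms], where f = fps_to_fls]
  by (simp add: fls_times_fps_to_fls fps_to_fls_power fps_to_fls_prod)

text \<open>The factor (q^2;q^2)_N removes the dependence on \<open>N\<close>, here and in the
  analogue for \<open>spt\<close>.\<close>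

lemma fls_count_gf_admissible:
  fixes q :: "rat fls"
  defines "q \<equiv> fls_X"
  assumes "l \<in> {1..N}"
  shows "qpoch (q\<^sup>2) (q\<^sup>2) N * fps_to_fls (count_gf (\<lambda>x. x) (insert l (admissible_parts N l)) l) =
    q ^ l * qpoch q q l / ((1 - q ^ l)\<^sup>2 * qpoch q (q\<^sup>2) l)"
proof -
  let ?w = "fps_to_fls (count_gf (\<lambda>x. x) (insert l (admissible_parts N l)) l)"
  let ?P = "\<Prod>a\<in>admissible_parts N l. 1 - q ^ a"
  have 1: "?w * ((1 - q ^ l)\<^sup>2 * ?P) = q ^ l"
    unfolding q_def by (rule fls_count_gf) (use assms in \<open>auto simp: admissible_parts_def\<close>)
  have 2: "?P * qpoch q q l = qpoch q (q\<^sup>2) l * qpoch (q\<^sup>2) (q\<^sup>2) N"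
    by (rule prod_admissible_parts) (use assms fls_X_power_neq_1 in auto)
  have "(1 - q ^ l)\<^sup>2 \<noteq> 0" using fls_X_power_neq_1[of l] assms by auto
  moreover have "qpoch q (q\<^sup>2) l \<noteq> 0"
    unfolding q_def using qpoch_fls_nonzero[of 1 2 l] by simp
  moreover have "qpoch (q\<^sup>2) (q\<^sup>2) N * ?w * ((1 - q ^ l)\<^sup>2 * qpoch q (q\<^sup>2) l) =
     (?w * ((1 - q ^ l)\<^sup>2 * ?P)) * qpoch q q l"
    using 2 by (metis (no_types, lifting) mult.assoc mult.commute)
  ultimately show ?thesis unfolding 1 by (simp add: nonzero_eq_divide_eq)
qed

lemma fls_count_gf_double:
  fixes q :: "rat fls"
  defines "q \<equiv> fls_X"
  assumes "l \<in> {1..N}"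
  shows "qpoch (q\<^sup>2) (q\<^sup>2) N * fps_to_fls (count_gf (\<lambda>x. 2 * x) {l..N} l) =
    q ^ (2 * l) * qpoch (q\<^sup>2) (q\<^sup>2) l / (1 - q ^ (2 * l))\<^sup>2"
proof -
  let ?v = "fps_to_fls (count_gf (\<lambda>x. 2 * x) {l..N} l)"
  have "{l..N} = insert l {l<..N}" using assms by auto
  then have 1: "?v *
      ((1 - q ^ (2 * l))\<^sup>2 * (\<Prod>a\<in>{l<..N}. 1 - q ^ (2 * a))) = q ^ (2 * l)"
    unfolding q_def by (simp only:) (rule fls_count_gf[where w = "\<lambda>x. 2 * x"], use assms in auto)
  have 2: "qpoch (q\<^sup>2) (q\<^sup>2) l * (\<Prod>a\<in>{l<..N}. 1 - q ^ (2 * a)) = qpoch (q\<^sup>2) (q\<^sup>2) N"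
    using qpoch_prod_greaterThanAtMost[of l N "q\<^sup>2"] assms by (simp add: power_mult)
  have "(1 - q ^ (2 * l))\<^sup>2 \<noteq> 0" using fls_X_power_neq_1[of "2 * l"] assms by auto
  moreover have "qpoch (q\<^sup>2) (q\<^sup>2) N * ?v * (1 - q ^ (2 * l))\<^sup>2 =
      (?v * ((1 - q ^ (2 * l))\<^sup>2 * (\<Prod>a\<in>{l<..N}. 1 - q ^ (2 * a)))) * qpoch (q\<^sup>2) (q\<^sup>2) l"
    using 2 by (metis (no_types, lifting) mult.assoc mult.commute)
  ultimately show ?thesis unfolding 1 by (simp add: nonzero_eq_divide_eq)
qed

section \<open>Expansion, exchange of summations and evaluation of the inner sums\<close>

text \<open>The summand k = 0 of \<open>inverse_qpoch_expansion\<close> is moved to the other side,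
  where it produces 1 - q^(l choose 2).\<close>

lemma admissible_term_expansion:
  fixes q :: "'a::field"
  assumes q: "\<And>j. j > 0 \<Longrightarrow> q ^ j \<noteq> 1"
  shows "q ^ l * (1 - q ^ (l choose 2)) * qpoch q q l / ((1 - q ^ l)\<^sup>2 * qpoch q (q\<^sup>2) l) =
    (\<Sum>k=1..l div 2. q ^ l * (qpoch q q l)\<^sup>2 / ((1 - q ^ l)\<^sup>2 * qpoch q (q\<^sup>2) l) *
      (q ^ (l - 2 * k choose 2) / (qpoch q q (l - 2 * k) * qpoch (q\<^sup>2) (q\<^sup>2) k)))"
proof -
  let ?f = "\<lambda>k. q ^ (l - 2 * k choose 2) / (qpoch q q (l - 2 * k) * qpoch (q\<^sup>2) (q\<^sup>2) k)"
  have P: "qpoch q q l \<noteq> 0"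
    by (rule qpoch_nonzero) (metis power_Suc q zero_less_Suc)
  have "{..l div 2} = insert 0 {1..l div 2}" by auto
  then have "1 / qpoch q q l - q ^ (l choose 2) / qpoch q q l = (\<Sum>k=1..l div 2. ?f k)"
    using inverse_qpoch_expansion[OF q, of l] by simp
  then have *: "(1 - q ^ (l choose 2)) / qpoch q q l = (\<Sum>k=1..l div 2. ?f k)"
    by (simp add: diff_divide_distrib)
  have "q ^ l * (1 - q ^ (l choose 2)) * qpoch q q l / ((1 - q ^ l)\<^sup>2 * qpoch q (q\<^sup>2) l) =
    q ^ l * (qpoch q q l)\<^sup>2 / ((1 - q ^ l)\<^sup>2 * qpoch q (q\<^sup>2) l) * ((1 - q ^ (l choose 2)) / qpoch q q l)"
    using P by (simp add: power2_eq_square mult_ac)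
  then show ?thesis unfolding * by (simp only: sum_distrib_left)
qed

text \<open>Here l = 2k + m and r = 2k - 1. The squared (q)_l contains (q^(2k))_m twice, which gives
  a = b = q^(2k), and its last factor cancels the squared denominator.\<close>

lemma gauss_term_reindex:
  fixes q :: "'a::field"
  assumes q: "\<And>j. j > 0 \<Longrightarrow> q ^ j \<noteq> 1" and k: "2 * k = Suc r"
  shows "q ^ (2 * k + m) * (qpoch q q (2 * k + m))\<^sup>2 / ((1 - q ^ (2 * k + m))\<^sup>2 * qpoch q (q\<^sup>2) (2 * k + m)) *
      (q ^ (m choose 2) / (qpoch q q m * qpoch (q\<^sup>2) (q\<^sup>2) k)) =
    q ^ (2 * k) * (qpoch q q r)\<^sup>2 / (qpoch q (q\<^sup>2) (2 * k) * qpoch (q\<^sup>2) (q\<^sup>2) k) *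
      gauss_term q (q ^ (2 * k)) (q ^ (2 * k)) m"
proof -
  have "q * q ^ r = q ^ (2 * k)" by (simp add: k)
  moreover have "qpoch q q (2 * k + m) = qpoch q q (r + m) * (1 - q ^ (2 * k + m))"
    by (simp add: k qpoch_Suc)
  ultimately have 1: "qpoch q q (2 * k + m) = qpoch q q r * qpoch (q ^ (2 * k)) q m * (1 - q ^ (2 * k + m))"
    by (simp only: qpoch_add)
  have 2: "qpoch q (q\<^sup>2) (2 * k + m) = qpoch q (q\<^sup>2) (2 * k) * qpoch (q ^ (2 * k) * q ^ (2 * k) * q) (q\<^sup>2) m"
  proof -
    have "q * (q\<^sup>2) ^ (2 * k) = q ^ (2 * k) * q ^ (2 * k) * q"
      by (simp only: power_mult[symmetric] power_add[symmetric] mult_2 mult.commute[of q])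
    then show ?thesis by (simp only: qpoch_add)
  qed
  have 3: "1 - q ^ (2 * k + m) \<noteq> 0" using q[of "2 * k + m"] k by simp
  show ?thesis
    unfolding 1 2 gauss_term_def Suc_choose_2 using 3
    by (simp add: power_mult_distrib power_add power2_eq_square mult_ac)
qed

text \<open>This is \<open>fls_vanishes_gauss_sum\<close> with i = k, multiplied by a
  prefactor.\<close>

lemma fls_vanishes_inner_sum:
  fixes q :: "rat fls"
  defines "q \<equiv> fls_X"
  assumes k: "2 * k = Suc r" "2 * k \<le> N"
  shows "fls_vanishes (Suc N)
    ((\<Sum>m\<le>N - 2 * k. q ^ (2 * k) * (qpoch q q r)\<^sup>2 / (qpoch q (q\<^sup>2) (2 * k) * qpoch (q\<^sup>2) (q\<^sup>2) k) *
        gauss_term q (q ^ (2 * k)) (q ^ (2 * k)) m)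
      - q ^ (2 * k) * qpoch (q\<^sup>2) (q\<^sup>2) k / (1 - q ^ (2 * k))\<^sup>2)"
proof -
  define c where "c = (qpoch q q r)\<^sup>2 / (qpoch q (q\<^sup>2) (2 * k) * qpoch (q\<^sup>2) (q\<^sup>2) k)"
  let ?S = "\<Sum>m\<le>N - 2 * k. gauss_term q (q ^ (2 * k)) (q ^ (2 * k)) m"
  let ?R = "qpoch (q ^ (2 * k + 1)) (q\<^sup>2) k"
  let ?O = "qpoch q (q\<^sup>2) k"
  let ?E = "qpoch (q\<^sup>2) (q\<^sup>2) k"
  have O: "?O \<noteq> 0" unfolding q_def using qpoch_fls_nonzero[of 1 2 k] by simp
  have R: "?R \<noteq> 0" unfolding q_def using qpoch_fls_nonzero[of "2 * k + 1" 2 k] by simp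
  have E: "?E \<noteq> 0" unfolding q_def using qpoch_fls_nonzero[of 2 2 k] by simp
  have x: "1 - q ^ (2 * k) \<noteq> 0" unfolding q_def using fls_X_power_neq_1[of "2 * k"] k by simp
  have "q * q ^ r = q ^ (2 * k)" by (simp add: k)
  then have "qpoch q q r * (1 - q ^ (2 * k)) = qpoch q q (2 * k)"
    unfolding k(1) qpoch_Suc by simp
  then have P: "qpoch q q r = ?O * ?E / (1 - q ^ (2 * k))"
    using x by (simp add: qpoch_double nonzero_eq_divide_eq)
  have "qpoch q (q\<^sup>2) (2 * k) = ?O * qpoch (q * (q\<^sup>2) ^ k) (q\<^sup>2) k"
    unfolding mult_2 by (rule qpoch_add)
  also have "q * (q\<^sup>2) ^ k = q ^ (2 * k + 1)" by (simp only: power_mult[symmetric] power_add power_one_right mult.commute)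
  finally have OO: "qpoch q (q\<^sup>2) (2 * k) = ?O * ?R" .
  \<comment> \<open>All odd-exponent factors cancel, which leaves the term of
    \<open>spt\<close>.\<close>
  have cR: "c * (?R / ?O) = ?E / (1 - q ^ (2 * k))\<^sup>2"
    unfolding c_def OO P using O R E x by (simp add: divide_simps power2_eq_square)
  have "fls_vanishes 0 c"
  proof -
    have "fls_vanishes 0 (qpoch q q r * qpoch q q r * (1 / qpoch q (q\<^sup>2) (2 * k)) * (1 / ?E))"
      unfolding q_def
      by (intro fls_vanishes_mult_left fls_vanishes_qpoch[of 1 1, simplified]
        fls_vanishes_inverse_qpoch[of 1 2, simplified] fls_vanishes_inverse_qpoch[of 2 2]) simp_all
    then show ?thesis by (simp add: c_def power2_eq_square)
  qed
  moreover have "fls_vanishes (Suc (N - 2 * k)) (?S - ?R / ?O)"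
    unfolding q_def by (rule fls_vanishes_gauss_sum)
  ultimately have "fls_vanishes (Suc (N - 2 * k)) (c * (?S - ?R / ?O))"
    by (rule fls_vanishes_mult_left)
  \<comment> \<open>The factor q^(2k) regains the precision lost by truncating the inner sum at
    \<open>N - 2 * k\<close>.\<close>
  then have "fls_vanishes (2 * k + Suc (N - 2 * k)) (q ^ (2 * k) * (c * (?S - ?R / ?O)))"
    unfolding q_def by (intro fls_vanishes_mult fls_vanishes_X_power) simp_all
  moreover have "2 * k + Suc (N - 2 * k) = Suc N" using k by simp
  moreover have "q ^ (2 * k) * (c * (?S - ?R / ?O)) = q ^ (2 * k) * c * ?S - q ^ (2 * k) * (c * (?R / ?O))"
    by (simp only: right_diff_distrib mult.assoc)
  ultimately have "fls_vanishes (Suc N) (q ^ (2 * k) * c * ?S - q ^ (2 * k) * (c * (?R / ?O)))"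
    by simp
  then show ?thesis unfolding cR by (simp add: sum_distrib_left c_def)
qed

text \<open>Substitution l = 2k + m.\<close>

lemma sum_triangle_swap:
  fixes f :: "nat \<Rightarrow> nat \<Rightarrow> 'a::comm_monoid_add"
  shows "(\<Sum>l=1..N. \<Sum>k=1..l div 2. f k l) = (\<Sum>k=1..N div 2. \<Sum>m\<le>N - 2 * k. f k (2 * k + m))"
proof -
  have "(\<Sum>l=1..N. \<Sum>k=1..l div 2. f k l) = (\<Sum>(l, k)\<in>(SIGMA l:{1..N}. {1..l div 2}). f k l)"
    by (rule sum.Sigma) auto
  also have "\<dots> = (\<Sum>(k, m)\<in>(SIGMA k:{1..N div 2}. {..N - 2 * k}). f k (2 * k + m))"
    by (rule sum.reindex_bij_witness[where
          i = "\<lambda>(k, m). (2 * k + m, k)" and j = "\<lambda>(l, k). (k, l - 2 * k)"]) auto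
  also have "\<dots> = (\<Sum>k=1..N div 2. \<Sum>m\<le>N - 2 * k. f k (2 * k + m))"
    by (rule sum.Sigma[symmetric]) auto
  finally show ?thesis .
qed

lemma fls_vanishes_spt_o_identity:
  fixes q :: "rat fls"
  defines "q \<equiv> fls_X"
  shows "fls_vanishes (Suc N)
    ((\<Sum>l=1..N. q ^ l * (1 - q ^ (l choose 2)) * qpoch q q l / ((1 - q ^ l)\<^sup>2 * qpoch q (q\<^sup>2) l)) -
     (\<Sum>k=1..N. q ^ (2 * k) * qpoch (q\<^sup>2) (q\<^sup>2) k / (1 - q ^ (2 * k))\<^sup>2))"
proof -
  have q: "q ^ j \<noteq> 1" if "j > 0" for j using that by (simp add: q_def fls_X_power_neq_1)
  define F where "F k l = q ^ l * (qpoch q q l)\<^sup>2 / ((1 - q ^ l)\<^sup>2 * qpoch q (q\<^sup>2) l) *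
      (q ^ (l - 2 * k choose 2) / (qpoch q q (l - 2 * k) * qpoch (q\<^sup>2) (q\<^sup>2) k))" for k l
  define G where "G k = q ^ (2 * k) * qpoch (q\<^sup>2) (q\<^sup>2) k / (1 - q ^ (2 * k))\<^sup>2" for k
  have "(\<Sum>l=1..N. q ^ l * (1 - q ^ (l choose 2)) * qpoch q q l / ((1 - q ^ l)\<^sup>2 * qpoch q (q\<^sup>2) l)) =
      (\<Sum>l=1..N. \<Sum>k=1..l div 2. F k l)"
    unfolding F_def by (intro sum.cong refl admissible_term_expansion q)
  also have "\<dots> = (\<Sum>k=1..N div 2. \<Sum>m\<le>N - 2 * k. F k (2 * k + m))"
    by (rule sum_triangle_swap)
  finally have lhs: "(\<Sum>l=1..N. q ^ l * (1 - q ^ (l choose 2)) * qpoch q q l / ((1 - q ^ l)\<^sup>2 * qpoch q (q\<^sup>2) l)) = \<dots>" .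
  \<comment> \<open>Inner sums exist only for k up to \<open>N div 2\<close>. For larger k the
    factor q^(2k) already vanishes modulo q^(N+1).\<close>
  have split: "{1..N} = {1..N div 2} \<union> {N div 2<..N}" by auto
  have rhs: "(\<Sum>k=1..N. G k) = (\<Sum>k=1..N div 2. G k) + (\<Sum>k\<in>{N div 2<..N}. G k)"
    unfolding split by (rule sum.union_disjoint) auto
  have "fls_vanishes (Suc N) (\<Sum>k=1..N div 2. (\<Sum>m\<le>N - 2 * k. F k (2 * k + m)) - G k)"
  proof (rule fls_vanishes_sum)
    fix k assume k: "k \<in> {1..N div 2}"
    then have r: "2 * k = Suc (2 * k - 1)" by auto
    have F: "F k (2 * k + m) = q ^ (2 * k) * (qpoch q q (2 * k - 1))\<^sup>2 /
        (qpoch q (q\<^sup>2) (2 * k) * qpoch (q\<^sup>2) (q\<^sup>2) k) * gauss_term q (q ^ (2 * k)) (q ^ (2 * k)) m" for m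
      unfolding F_def diff_add_inverse by (rule gauss_term_reindex[OF _ r]) (rule q)
    show "fls_vanishes (Suc N) ((\<Sum>m\<le>N - 2 * k. F k (2 * k + m)) - G k)"
      unfolding F G_def unfolding q_def by (rule fls_vanishes_inner_sum[OF r]) (use k in auto)
  qed
  moreover have "fls_vanishes (Suc N) (\<Sum>k\<in>{N div 2<..N}. G k)"
  proof (rule fls_vanishes_sum)
    fix k assume k: "k \<in> {N div 2<..N}"
    have inv: "fls_vanishes 0 (1 / (1 - q ^ (2 * k)))"
      using fls_vanishes_inverse_qpoch[of "2 * k" 0 1] k by (simp add: qpoch_Suc q_def)
    have "fls_vanishes (Suc N) ((1 / (1 - q ^ (2 * k))) * ((1 / (1 - q ^ (2 * k))) *
        (qpoch (q\<^sup>2) (q\<^sup>2) k * q ^ (2 * k))))"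
    proof (intro fls_vanishes_mult_left[OF inv] fls_vanishes_mult_left)
      show "fls_vanishes 0 (qpoch (q\<^sup>2) (q\<^sup>2) k)" unfolding q_def by (rule fls_vanishes_qpoch)
      show "fls_vanishes (Suc N) (q ^ (2 * k))"
        unfolding q_def by (rule fls_vanishes_X_power) (use k in auto)
    qed
    then show "fls_vanishes (Suc N) (G k)" by (simp add: G_def power2_eq_square mult_ac)
  qed
  ultimately have "fls_vanishes (Suc N) ((\<Sum>k=1..N div 2. (\<Sum>m\<le>N - 2 * k. F k (2 * k + m)) - G k)
      - (\<Sum>k\<in>{N div 2<..N}. G k))"
    by (rule fls_vanishes_diff)
  then show ?thesis
    unfolding lhs G_def[symmetric] rhs by (simp add: sum_subtractf diff_diff_eq)
qed

section \<open>Comparison of the coefficients of q^(2n)\<close>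

theorem theorem2:
  fixes n :: nat
  assumes "n \<ge> 1"
  shows "spt_o (2 * n) = int (spt n)"
proof -
  \<comment> \<open>A congruence modulo q^(N+1) just reaches the coefficient of q^(2n).\<close>
  define N where "N = 2 * n"
  define q :: "rat fls" where "q = fls_X"
  define W where "W l = count_gf (\<lambda>x. x) (insert l (admissible_parts N l)) l" for l
  define V where "V l = count_gf (\<lambda>x. 2 * x) {l..N} l" for l
  define D where "D = (\<Sum>l=1..N. (1 - fps_X ^ (l choose 2)) * W l) - (\<Sum>l=1..N. V l)"
  define E where "E = qpoch (q\<^sup>2) (q\<^sup>2) N"
  have "E * fps_to_fls D =
      (\<Sum>l=1..N. (1 - q ^ (l choose 2)) * (E * fps_to_fls (W l))) - (\<Sum>l=1..N. E * fps_to_fls (V l))"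
    by (simp add: D_def fps_to_fls_sum fls_times_fps_to_fls fps_to_fls_power q_def
        right_diff_distrib sum_distrib_left mult_ac)
  also have "(\<Sum>l=1..N. (1 - q ^ (l choose 2)) * (E * fps_to_fls (W l))) =
      (\<Sum>l=1..N. q ^ l * (1 - q ^ (l choose 2)) * qpoch q q l / ((1 - q ^ l)\<^sup>2 * qpoch q (q\<^sup>2) l))"
  proof (rule sum.cong[OF refl])
    fix l assume "l \<in> {1..N}"
    from fls_count_gf_admissible[OF this]
    have "E * fps_to_fls (W l) = q ^ l * qpoch q q l / ((1 - q ^ l)\<^sup>2 * qpoch q (q\<^sup>2) l)"
      unfolding E_def W_def q_def .
    then show "(1 - q ^ (l choose 2)) * (E * fps_to_fls (W l)) =
        q ^ l * (1 - q ^ (l choose 2)) * qpoch q q l / ((1 - q ^ l)\<^sup>2 * qpoch q (q\<^sup>2) l)"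
      by (simp only: times_divide_eq_right mult_ac)
  qed
  also have "(\<Sum>l=1..N. E * fps_to_fls (V l)) =
      (\<Sum>l=1..N. q ^ (2 * l) * qpoch (q\<^sup>2) (q\<^sup>2) l / (1 - q ^ (2 * l))\<^sup>2)"
    unfolding E_def V_def q_def by (rule sum.cong) (simp_all add: fls_count_gf_double)
  finally have "fls_vanishes (Suc N) (E * fps_to_fls D)"
    using fls_vanishes_spt_o_identity[of N] unfolding q_def by simp
  \<comment> \<open>\<open>E\<close> has constant term 1, so dividing by it preserves the
    congruence.\<close>
  moreover have "fls_vanishes 0 (1 / E)"
    unfolding E_def q_def by (rule fls_vanishes_inverse_qpoch) simp
  ultimately have "fls_vanishes (Suc N) (1 / E * (E * fps_to_fls D))"
    by (rule fls_vanishes_mult_left[rotated])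
  moreover have "E \<noteq> 0" unfolding E_def q_def by (rule qpoch_fls_nonzero) simp
  ultimately have "fls_vanishes (Suc N) (fps_to_fls D)" by simp
  then have "D $ (2 * n) = 0" by (rule fls_vanishes_nth) (simp add: N_def)
  moreover have "of_nat (spt_o_plus (2 * n)) = (\<Sum>l=1..N. W l) $ (2 * n)"
    unfolding W_def by (rule spt_o_plus_eq_count_gf) (simp add: N_def)
  moreover have "of_nat (spt_o_minus (2 * n)) = (\<Sum>l=1..N. fps_X ^ (l choose 2) * W l) $ (2 * n)"
    unfolding W_def by (rule spt_o_minus_eq_count_gf) (simp add: N_def)
  moreover have "of_nat (spt n) = (\<Sum>l=1..N. V l) $ (2 * n)"
    unfolding V_def by (rule spt_eq_count_gf) (simp add: N_def)
  ultimately have "(of_int (spt_o (2 * n)) :: rat) = of_int (int (spt n))"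
    by (simp add: spt_o_def D_def left_diff_distrib sum_subtractf)
  then show ?thesis by (simp only: of_int_eq_iff)
qed

end
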